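(* For every $h\in[H]$, $s\in\mathcal S$, $a\in\mathcal A_h(s)$, $\mathbf b=(b_{s'})_{s'\in\mathcal S}\in(\mathbb R^m)^S$, $u\in\mathbb R^m$ and $t\in[S+1]$, $$f^{s,a}_{h,\mathbf b}(t,u)\ \le\ \hat f^{s,a}_{h,\mathbf b}(t,u)\ \le\ f^{s,a}_{h,\mathbf b}(t,u)+(S-t+1)\ell.$$
   Context: Setting. We have a finite state set $\mathcal S=\{1,\dots,S\}$, action sets $\mathcal A_h(s)$, and transition distributions $P_h(\cdot\mid s,a)$ for $h\in[H]$. Vector inequalities are componentwise, and scalars added to vectors are added to each coordinate. SR functions. Let $f:\mathbb R^m\times\mathbb R^m\to\mathbb R^m$ satisfy: - $f$ is associative; - $f$ is componentwise non-decreasing in each argument; - $f$ is $1$-Lipschitz in each argument for $\|\cdot\|_\infty$; - $f(0,x)=f(x,0)=x$. Let $g:[0,1]\to[0,1]$ satisfy $g(0)=0$. Write $f_{s'=t}^S y_{s'}=f(y_t,f(y_{t+1},\dots,y_S))$. Assume $x\mapsto f_{s'=1}^S g(p_{s'})x_{s'}$ is $1$-Lipschitz for $\|\cdot\|_\infty$ for every probability vector $p$. Exact aggregate. $f^{s,a}_{h,\mathbf b}(t,F)=f\big(F,f_{s'=t}^S g(P_h(s'\mid s,a))b_{s'}\big)$, equal to $F$ when $t=S+1$. Rounded aggregate. Fix $\ell>0$ and let $\lceil x\rceil_\ell=\lceil x/\ell\rceil\ell$ componentwise (smallest integer multiple of $\ell$ that is at least $x$). Define $\hat f^{s,a}_{h,\mathbf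 b}(S+1,F)=F$ and $\hat f^{s,a}_{h,\mathbf b}(t,F)=\hat f^{s,a}_{h,\mathbf b}\big(t+1,\lceil f(F,g(P_h(t\mid s,a))b_t)\rceil_\ell\big)$ for $t\in[S]$. *)

theory Defs
  imports "HOL-Analysis.Analysis"
begin

definition prob_vector :: "nat \<Rightarrow> (nat \<Rightarrow> real) \<Rightarrow> bool" where
  "prob_vector S p \<longleftrightarrow> (\<forall>s\<in>{1..S}. 0 \<le> p s) \<and> (\<Sum>s=1..S. p s) = 1"

text \<open>Right-nested iteration \<open>f (y t) (f (y (t+1)) (\<dots> (f (y (S-1)) (y S))))\<close>, for \<open>t \<le> S\<close>.\<close>

definition iter_agg :: "('v \<Rightarrow> 'v \<Rightarrow> 'v) \<Rightarrow> (nat \<Rightarrow> 'v) \<Rightarrow> nat \<Rightarrow> nat \<Rightarrow> 'v" where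
  "iter_agg f y t S = foldr (\<lambda>s'. f (y s')) [t..<S] (y S)"

text \<open>The sup norm on families \<open>(x s)\<close>, \<open>1 \<le> s \<le> S\<close>; intended for \<open>S \<ge> 1\<close>.\<close>

definition family_norm :: "nat \<Rightarrow> (nat \<Rightarrow> real ^ 'm) \<Rightarrow> real" where
  "family_norm S x = (MAX s\<in>{1..S}. infnorm (x s))"

text \<open>The order on \<open>real ^ 'm\<close> is the componentwise one and \<open>infnorm\<close> is the maximum norm.\<close>

definition SR_operator :: "(real ^ 'm \<Rightarrow> real ^ 'm \<Rightarrow> real ^ 'm) \<Rightarrow> bool" where
  "SR_operator f \<longleftrightarrow>
     (\<forall>x y z. f (f x y) z = f x (f y z)) \<and>
     (\<forall>x x' y. x \<le> x' \<longrightarrow> f x y \<le> f x' y) \<and>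
     (\<forall>x y y'. y \<le> y' \<longrightarrow> f x y \<le> f x y') \<and>
     (\<forall>x x' y. infnorm (f x y - f x' y) \<le> infnorm (x - x')) \<and>
     (\<forall>x y y'. infnorm (f x y - f x y') \<le> infnorm (y - y')) \<and>
     (\<forall>x. f 0 x = x \<and> f x 0 = x)"

definition SR_weight :: "(real \<Rightarrow> real) \<Rightarrow> bool" where
  "SR_weight g \<longleftrightarrow> g \<in> {0..1} \<rightarrow> {0..1} \<and> g 0 = 0"

definition SR_aggregate_lipschitz ::
  "nat \<Rightarrow> (real ^ 'm \<Rightarrow> real ^ 'm \<Rightarrow> real ^ 'm) \<Rightarrow> (real \<Rightarrow> real) \<Rightarrow> bool" where
  "SR_aggregate_lipschitz S f g \<longleftrightarrow>
     (\<forall>p. prob_vector S p \<longrightarrow>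
       (\<forall>x y. infnorm (iter_agg f (\<lambda>s'. g (p s') *\<^sub>R x s') 1 S
                     - iter_agg f (\<lambda>s'. g (p s') *\<^sub>R y s') 1 S)
              \<le> family_norm S (\<lambda>s'. x s' - y s')))"

text \<open>In the two aggregates below, \<open>p\<close> stands for the distribution \<open>P h s a\<close>, the only way in
  which they depend on \<open>h\<close>, \<open>s\<close> and \<open>a\<close>.\<close>

definition exact_agg ::
  "nat \<Rightarrow> (real ^ 'm \<Rightarrow> real ^ 'm \<Rightarrow> real ^ 'm) \<Rightarrow> (real \<Rightarrow> real) \<Rightarrow> (nat \<Rightarrow> real)
    \<Rightarrow> (nat \<Rightarrow> real ^ 'm) \<Rightarrow> nat \<Rightarrow> real ^ 'm \<Rightarrow> real ^ 'm" where
  "exact_agg S f g p b t F =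
     (if t = S + 1 then F else f F (iter_agg f (\<lambda>s'. g (p s') *\<^sub>R b s') t S))"

definition round_up :: "real \<Rightarrow> real ^ 'm \<Rightarrow> real ^ 'm" where
  "round_up l x = (\<chi> i. of_int \<lceil>x $ i / l\<rceil> * l)"

function rounded_agg ::
  "nat \<Rightarrow> real \<Rightarrow> (real ^ 'm \<Rightarrow> real ^ 'm \<Rightarrow> real ^ 'm) \<Rightarrow> (real \<Rightarrow> real) \<Rightarrow> (nat \<Rightarrow> real)
    \<Rightarrow> (nat \<Rightarrow> real ^ 'm) \<Rightarrow> nat \<Rightarrow> real ^ 'm \<Rightarrow> real ^ 'm" where
  "rounded_agg S l f g p b t F =
     (if t \<le> S then rounded_agg S l f g p b (t + 1) (round_up l (f F (g (p t) *\<^sub>R b t))) else F)"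
  by pat_completeness auto
termination
  by (relation "Wellfounded.measure (\<lambda>(S, l, f, g, p, b, t, F). S + 1 - t)") auto

declare rounded_agg.simps [simp del]

end

theory Submission
  imports Defs
begin

text \<open>By associativity, the exact aggregate satisfies the recursion of the rounded one with the
  rounding left out. Backward induction on \<open>t\<close> then gives both bounds: monotonicity in \<open>F\<close> shows
  that rounding up never decreases the value, and the Lipschitz property in \<open>F\<close> shows that each of
  the \<open>S - t + 1\<close> roundings costs at most \<open>l\<close>.\<close>

text \<open>\<open>infnorm\<close> is a supremum of \<open>\<bar>x \<bullet> i\<bar>\<close> over
  the basis, and these inner products are the coordinates up to absolute value.\<close>

lemma infnorm_le_cart:
  fixes x :: "real ^ 'm"
  assumes "\<And>i. \<bar>x $ i\<bar> \<le> c"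
  shows "infnorm x \<le> c"
  unfolding infnorm_def
proof (rule cSup_least)
  show "{\<bar>x \<bullet> i\<bar> |i. i \<in> Basis} \<noteq> {}"
    using nonempty_Basis by blast
qed (auto simp: Basis_vec_def inner_axis assms)

lemma le_round_up:
  assumes "l > 0"
  shows "x \<le> round_up l x"
proof -
  have "x $ i \<le> of_int \<lceil>x $ i / l\<rceil> * l" for i
    using mult_right_mono[OF le_of_int_ceiling[of "x $ i / l"], of l] assms by simp
  then show ?thesis
    by (simp add: less_eq_vec_def round_up_def)
qed

lemma round_up_le_add:
  assumes "l > 0"
  shows "round_up l x \<le> x + vec l"
proof -
  have "of_int \<lceil>x $ i / l\<rceil> * l \<le> x $ i + l" for i
    using mult_right_mono[OF of_int_ceiling_le_add_one[of "x $ i / l"], of l] assms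
    by (simp add: distrib_right)
  then show ?thesis
    by (simp add: less_eq_vec_def round_up_def)
qed

text \<open>Turns a Lipschitz estimate in the maximum norm back into a one-sided componentwise
  bound.\<close>

lemma le_add_vec_if_infnorm_diff_le:
  fixes x y :: "real ^ 'm"
  assumes "infnorm (x - y) \<le> c"
  shows "x \<le> y + vec c"
  unfolding less_eq_vec_def
proof
  fix i
  show "x $ i \<le> (y + vec c) $ i"
    using component_le_infnorm_cart[of "x - y" i] assms by simp
qed

text \<open>Associativity moves the head of the right-nested aggregate into the accumulator.\<close>

lemma exact_agg_step:
  assumes "SR_operator f" "t \<le> S"
  shows "exact_agg S f g p b t F = exact_agg S f g p b (t + 1) (f F (g (p t) *\<^sub>R b t))"
\<comment> \<open>At \<open>t = S\<close> the right-hand side falls into the exit branch of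
  \<open>exact_agg\<close>, and \<open>[S..<S]\<close> is empty, so only the last term of
  \<open>iter_agg\<close> remains.\<close>
proof (cases "t = S")
  case True
  then show ?thesis
    by (simp add: exact_agg_def iter_agg_def)
next
  case False
  with assms show ?thesis
    by (simp add: exact_agg_def iter_agg_def SR_operator_def upt_conv_Cons)
qed

lemma exact_agg_mono:
  assumes "SR_operator f" "F \<le> F'"
  shows "exact_agg S f g p b t F \<le> exact_agg S f g p b t F'"
  using assms by (simp add: exact_agg_def SR_operator_def)

text \<open>The two-sided order bound on \<open>F' - F\<close> bounds its norm by \<open>c\<close>,
  and the map \<open>F \<mapsto> exact_agg S f g p b t F\<close> is 1-Lipschitz because
  \<open>f\<close> is so in its first argument.\<close>

lemma exact_agg_le_add:
  assumes "SR_operator f" "F \<le> F'" "F' \<le> F + vec c"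
  shows "exact_agg S f g p b t F' \<le> exact_agg S f g p b t F + vec c"
proof (rule le_add_vec_if_infnorm_diff_le)
  have "\<bar>(F' - F) $ i\<bar> \<le> c" for i
    using assms(2,3)[unfolded less_eq_vec_def, rule_format, of i] by simp
  then have "infnorm (F' - F) \<le> c"
    by (rule infnorm_le_cart)
  moreover have "infnorm (exact_agg S f g p b t F' - exact_agg S f g p b t F) \<le> infnorm (F' - F)"
    using assms(1) by (simp add: exact_agg_def SR_operator_def)
  ultimately show "infnorm (exact_agg S f g p b t F' - exact_agg S f g p b t F) \<le> c"
    by simp
qed

lemma rounded_agg_bounds:
  assumes f: "SR_operator f" and l: "l > 0" and "t \<le> S + 1"
  shows "exact_agg S f g p b t F \<le> rounded_agg S l f g p b t F \<and>
    rounded_agg S l f g p b t F \<le> exact_agg S f g p b t F + vec ((real S - real t + 1) * l)"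
  using \<open>t \<le> S + 1\<close>
\<comment> \<open>\<open>F\<close> must vary, since the hypothesis is applied to the rounded
  accumulator.\<close>
proof (induction t arbitrary: F rule: inc_induct)
  case base
  \<comment> \<open>The factor \<open>real S - real t + 1\<close> vanishes at
    \<open>t = S + 1\<close>; truncated subtraction on \<open>nat\<close> would leave an extra
    \<open>l\<close>.\<close>
  show ?case
    by (simp add: exact_agg_def rounded_agg.simps less_eq_vec_def)
next
  case (step t)
  let ?G = "f F (g (p t) *\<^sub>R b t)"
  let ?E = "exact_agg S f g p b (t + 1)" and ?R = "rounded_agg S l f g p b (t + 1)"
  have "t \<le> S"
    using step.hyps by simp
  then have E: "exact_agg S f g p b t F = ?E ?G"
    and R: "rounded_agg S l f g p b t F = ?R (round_up l ?G)"
    \<comment> \<open>Fixing the index \<open>t\<close> in the recursive equation keeps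
      \<open>?R\<close> folded.\<close>
    using exact_agg_step[OF f] by (simp_all add: rounded_agg.simps[of _ _ _ _ _ _ t])
  \<comment> \<open>At index \<open>t + 1\<close> the number of remaining roundings is
    \<open>S - t\<close>.\<close>
  have IH: "?E (round_up l ?G) \<le> ?R (round_up l ?G)"
    "?R (round_up l ?G) \<le> ?E (round_up l ?G) + vec ((real S - real t) * l)"
    using step.IH[of "round_up l ?G"] by simp_all
  have "?E ?G \<le> ?R (round_up l ?G)"
    using exact_agg_mono[OF f le_round_up[OF l]] IH(1) by (rule order_trans)
  moreover have "?R (round_up l ?G) \<le> (?E ?G + vec l) + vec ((real S - real t) * l)"
    using IH(2) add_right_mono[OF exact_agg_le_add[OF f le_round_up[OF l] round_up_le_add[OF l]]]
    by (rule order_trans)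
  moreover have "(?E ?G + vec l) + vec ((real S - real t) * l)
      = ?E ?G + vec ((real S - real t + 1) * l)"
    by (simp add: vec_eq_iff algebra_simps)
  ultimately show ?case
    unfolding E R by metis
qed

theorem mainTheorem11:
  fixes S H :: nat
    and A :: "nat \<Rightarrow> nat \<Rightarrow> 'a set"
    and P :: "nat \<Rightarrow> nat \<Rightarrow> 'a \<Rightarrow> nat \<Rightarrow> real"
    and f :: "real ^ 'm \<Rightarrow> real ^ 'm \<Rightarrow> real ^ 'm"
    and g :: "real \<Rightarrow> real"
    and l :: real
  assumes "\<And>h s a. h \<in> {1..H} \<Longrightarrow> s \<in> {1..S} \<Longrightarrow> a \<in> A h s \<Longrightarrow> prob_vector S (P h s a)"
    and "SR_operator f"
    and "SR_weight g"
    and "SR_aggregate_lipschitz S f g"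
    and "l > 0"
  shows "\<forall>h\<in>{1..H}. \<forall>s\<in>{1..S}. \<forall>a\<in>A h s. \<forall>b :: nat \<Rightarrow> real ^ 'm. \<forall>u :: real ^ 'm. \<forall>t\<in>{1..S+1}.
           exact_agg S f g (P h s a) b t u \<le> rounded_agg S l f g (P h s a) b t u \<and>
           rounded_agg S l f g (P h s a) b t u
             \<le> exact_agg S f g (P h s a) b t u + vec ((real S - real t + 1) * l)"
  using rounded_agg_bounds[OF assms(2,5)] by simp

end
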